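(* Let $\mathcal{K}$ be a class of transformation monoids and $\mathcal{C}$ a class of clones such that $F'^{(1)}\in\mathcal{K}$ for every $F'\in\mathcal{C}$. Let $F$ be a clone on a set $A$ whose unary part $F^{(1)}$ is weakly directed and has automatic action compatibility with respect to $\mathcal{K}$. Then $F$ has automatic action compatibility (and thus automatic homeomorphicity) with respect to $\mathcal{C}$.
   Context: A clone on $A$ is a set of finitary operations on $A$ containing all projections and closed under composition; $F^{(n)}$ denotes its $n$-ary part, and clone homomorphisms preserve arities, projections and composition. A transformation semigroup $S\subseteq A^A$ is weakly directed if for all $a,b\in A$ there exist $f,g\in S$ and $c\in A$ with $f(c)=a$, $g(c)=b$. A transformation monoid $M$ on $A$ has automatic action compatibility w.r.t. $\mathcal{K}$ if for every $M'\in\mathcal{K}$ on a set $B$ with $|B|=|A|$ and every monoid isomorphism $\phi\colon M\to M'$ there is a bijection $\theta\colon A\to B$ with $\phi(f)=\theta\circ f\circ\theta^{-1}$ for all $f\in M$. A clone $F$ on $A$ has automatic action compatibility w.r.t. $\mathcal{C}$ if for every $F'\in\mathcal{C}$ on a set $B$ with $|B|=|A|$ and every clone isomorphism $\xi\colon F\to F'$ there is a bijection $\theta\colon A\to B$ with $\xi(h)=\theta\circ h\circ(\theta^{-1}\times\cdots\times\theta^{-1})$ for all $h\in F$; automatic homeomorphicity means every such clone isomorphism is a homeomorphism w.r.t. the topology of pointwise convergence on each $F^{(n)}$ (disjoint union over $n$). *)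

theory Defs
  imports "HOL-Analysis.Analysis" "HOL-Algebra.Group" "HOL-Library.Equipollence"
begin

section \<open>Transformation monoids\<close>

text \<open>
  Self-maps of a carrier set \<open>A\<close> are represented by extensional functions, so that equality of maps
  on \<open>A\<close> is equality of functions; \<^term>\<open>compose A f g\<close> is \<open>f\<close> after \<open>g\<close>.
\<close>

definition full_trans_monoid :: "'a set \<Rightarrow> ('a \<Rightarrow> 'a) monoid" where
  "full_trans_monoid A =
     \<lparr>carrier = A \<rightarrow>\<^sub>E A, mult = compose A, one = (\<lambda>x\<in>A. x)\<rparr>"

definition trans_monoid :: "'a set \<Rightarrow> ('a \<Rightarrow> 'a) set \<Rightarrow> bool" where
  "trans_monoid A M \<longleftrightarrow> submonoid M (full_trans_monoid A)"

definition monoid_iso ::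
  "'a set \<Rightarrow> ('a \<Rightarrow> 'a) set \<Rightarrow> 'b set \<Rightarrow> ('b \<Rightarrow> 'b) set \<Rightarrow> (('a \<Rightarrow> 'a) \<Rightarrow> ('b \<Rightarrow> 'b)) \<Rightarrow> bool" where
  "monoid_iso A M B M' \<phi> \<longleftrightarrow>
     \<phi> \<in> iso ((full_trans_monoid A)\<lparr>carrier := M\<rparr>) ((full_trans_monoid B)\<lparr>carrier := M'\<rparr>) \<and>
     \<phi> (\<lambda>x\<in>A. x) = (\<lambda>y\<in>B. y)"

definition weakly_directed :: "'a set \<Rightarrow> ('a \<Rightarrow> 'a) set \<Rightarrow> bool" where
  "weakly_directed A S \<longleftrightarrow>
     (\<forall>a\<in>A. \<forall>b\<in>A. \<exists>f\<in>S. \<exists>g\<in>S. \<exists>c\<in>A. f c = a \<and> g c = b)"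

text \<open>
  A class of transformation monoids (and likewise, below, of clones) is a set of pairs of a carrier
  and a monoid (a clone) on it. Its members live on subsets of a type \<open>'b\<close> which is independent of
  the type \<open>'a\<close> of the structure under consideration.
\<close>

definition monoid_automatic_action_compat ::
  "'a set \<Rightarrow> ('a \<Rightarrow> 'a) set \<Rightarrow> ('b set \<times> ('b \<Rightarrow> 'b) set) set \<Rightarrow> bool" where
  "monoid_automatic_action_compat A M K \<longleftrightarrow>
     (\<forall>B M' \<phi>. (B, M') \<in> K \<and> A \<approx> B \<and> monoid_iso A M B M' \<phi> \<longrightarrow>
        (\<exists>\<theta>. bij_betw \<theta> A B \<and>
             (\<forall>f\<in>M. \<phi> f = (\<lambda>y\<in>B. \<theta> (f (inv_into A \<theta> y))))))"

section \<open>Clones\<close>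

text \<open>
  An operation is a pair of its arity and an extensional function on tuples; the explicit arity
  keeps operations of different arities apart even when \<open>A\<close> is empty.
  Arity \<open>0\<close> is admitted but not required: a clone without nullary operations in
  the sense below is the same thing as a clone in the convention that only allows positive arities.
\<close>

type_synonym 'a operation = "nat \<times> ('a list \<Rightarrow> 'a)"

definition tuples :: "'a set \<Rightarrow> nat \<Rightarrow> 'a list set" where
  "tuples A n = {xs. set xs \<subseteq> A \<and> length xs = n}"

definition operations :: "'a set \<Rightarrow> 'a operation set" where
  "operations A = (SIGMA n:UNIV. tuples A n \<rightarrow>\<^sub>E A)"

definition proj :: "'a set \<Rightarrow> nat \<Rightarrow> nat \<Rightarrow> 'a operation" where
  "proj A n i = (n, \<lambda>xs\<in>tuples A n. xs ! i)"

text \<open>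
  The composition of an operation \<open>h\<close> with a list \<open>gs\<close> of \<open>m\<close>-ary operations, one for
  each argument of \<open>h\<close>. The arity \<open>m\<close> is explicit since \<open>gs\<close> is empty for nullary \<open>h\<close>.
\<close>

definition op_comp :: "'a set \<Rightarrow> nat \<Rightarrow> 'a operation \<Rightarrow> 'a operation list \<Rightarrow> 'a operation" where
  "op_comp A m h gs = (m, \<lambda>xs\<in>tuples A m. snd h (map (\<lambda>g. snd g xs) gs))"

definition composable :: "'a operation set \<Rightarrow> nat \<Rightarrow> 'a operation \<Rightarrow> 'a operation list \<Rightarrow> bool" where
  "composable F m h gs \<longleftrightarrow>
     h \<in> F \<and> length gs = fst h \<and> (\<forall>g\<in>set gs. g \<in> F \<and> fst g = m)"

definition clone :: "'a set \<Rightarrow> 'a operation set \<Rightarrow> bool" where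
  "clone A F \<longleftrightarrow>
     F \<subseteq> operations A \<and>
     (\<forall>n i. i < n \<longrightarrow> proj A n i \<in> F) \<and>
     (\<forall>m h gs. composable F m h gs \<longrightarrow> op_comp A m h gs \<in> F)"

definition clone_part :: "'a operation set \<Rightarrow> nat \<Rightarrow> ('a list \<Rightarrow> 'a) set" where
  "clone_part F n = {f. (n, f) \<in> F}"

text \<open>
  The unary part as a set of self-maps of \<open>A\<close>, identifying \<open>1\<close>-tuples with elements.
\<close>

definition unary_part :: "'a set \<Rightarrow> 'a operation set \<Rightarrow> ('a \<Rightarrow> 'a) set" where
  "unary_part A F = (\<lambda>f. \<lambda>x\<in>A. f [x]) ` clone_part F 1"

definition clone_hom ::
  "'a set \<Rightarrow> 'a operation set \<Rightarrow> 'b set \<Rightarrow> 'b operation set \<Rightarrow> ('a operation \<Rightarrow> 'b operation) \<Rightarrow> bool" where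
  "clone_hom A F B F' \<xi> \<longleftrightarrow>
     \<xi> \<in> F \<rightarrow> F' \<and>
     (\<forall>h\<in>F. fst (\<xi> h) = fst h) \<and>
     (\<forall>n i. i < n \<longrightarrow> \<xi> (proj A n i) = proj B n i) \<and>
     (\<forall>m h gs. composable F m h gs \<longrightarrow> \<xi> (op_comp A m h gs) = op_comp B m (\<xi> h) (map \<xi> gs))"

definition clone_iso ::
  "'a set \<Rightarrow> 'a operation set \<Rightarrow> 'b set \<Rightarrow> 'b operation set \<Rightarrow> ('a operation \<Rightarrow> 'b operation) \<Rightarrow> bool" where
  "clone_iso A F B F' \<xi> \<longleftrightarrow> clone_hom A F B F' \<xi> \<and> bij_betw \<xi> F F'"

definition clone_automatic_action_compat ::
  "'a set \<Rightarrow> 'a operation set \<Rightarrow> ('b set \<times> 'b operation set) set \<Rightarrow> bool" where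
  "clone_automatic_action_compat A F C \<longleftrightarrow>
     (\<forall>B F' \<xi>. (B, F') \<in> C \<and> A \<approx> B \<and> clone_iso A F B F' \<xi> \<longrightarrow>
        (\<exists>\<theta>. bij_betw \<theta> A B \<and>
             (\<forall>h\<in>F. \<xi> h =
                (fst h, \<lambda>ys\<in>tuples B (fst h). \<theta> (snd h (map (inv_into A \<theta>) ys))))))"

text \<open>
  Pointwise convergence: each \<open>n\<close>-ary part is a subspace of the power of the discrete space \<open>A\<close>
  indexed by the \<open>n\<close>-tuples, and the clone is the disjoint union of its parts.
\<close>

definition clone_topology :: "'a set \<Rightarrow> 'a operation set \<Rightarrow> 'a operation topology" where
  "clone_topology A F =
     sum_topology
       (\<lambda>n. subtopology (product_topology (\<lambda>_. discrete_topology A) (tuples A n)) (clone_part F n))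
       UNIV"

lemma topspace_clone_topology:
  assumes "F \<subseteq> operations A"
  shows "topspace (clone_topology A F) = F"
  using assms by (fastforce simp: clone_topology_def operations_def clone_part_def)

definition clone_automatic_homeomorphicity ::
  "'a set \<Rightarrow> 'a operation set \<Rightarrow> ('b set \<times> 'b operation set) set \<Rightarrow> bool" where
  "clone_automatic_homeomorphicity A F C \<longleftrightarrow>
     (\<forall>B F' \<xi>. (B, F') \<in> C \<and> A \<approx> B \<and> clone_iso A F B F' \<xi> \<longrightarrow>
        homeomorphic_map (clone_topology A F) (clone_topology B F') \<xi>)"

end

theory Submission
  imports Defs
begin

text \<open>
  Weak directedness extends from pairs to finite tuples: any \<open>xs \<in> A\<^sup>n\<close> is of the form
  \<open>(f\<^sub>1 c, \<dots>, f\<^sub>n c)\<close> with unary \<open>f\<^sub>i \<in> F\<close>. Hence the value of \<open>h\<close> at \<open>xs\<close> is the value of the unary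
  operation \<open>h(f\<^sub>1, \<dots>, f\<^sub>n)\<close> at \<open>c\<close>, so a bijection that induces a clone isomorphism on the unary
  part induces it everywhere. Conjugation by a bijection is a homeomorphism for pointwise
  convergence.
\<close>

section \<open>Unary operations as self-maps\<close>

text \<open>Clone isomorphisms act on operations with an arity tag, whereas the unary part consists
  of self-maps; \<open>op_of_map\<close> and \<open>map_of_op\<close> translate. Both restrict,
  which makes them mutually inverse between unary operations and extensional self-maps.\<close>

definition op_of_map :: "'a set \<Rightarrow> ('a \<Rightarrow> 'a) \<Rightarrow> 'a operation" where
  "op_of_map A f = (1, \<lambda>xs\<in>tuples A 1. f (hd xs))"

definition map_of_op :: "'a set \<Rightarrow> 'a operation \<Rightarrow> ('a \<Rightarrow> 'a)" where
  "map_of_op A h = (\<lambda>x\<in>A. snd h [x])"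

text \<open>The map \<open>\<sigma>\<close> is an argument of its own rather than
  \<open>inv_into A \<theta>\<close>, so that exchanging the two maps gives conjugation in the
  opposite direction.\<close>

definition op_conj :: "'b set \<Rightarrow> ('a \<Rightarrow> 'b) \<Rightarrow> ('b \<Rightarrow> 'a) \<Rightarrow> 'a operation \<Rightarrow> 'b operation" where
  "op_conj B \<theta> \<sigma> h = (fst h, \<lambda>ys\<in>tuples B (fst h). \<theta> (snd h (map \<sigma> ys)))"

lemma tuples_1: "tuples A (Suc 0) = (\<lambda>x. [x]) ` A"
  by (auto simp: tuples_def length_Suc_conv)

lemma singleton_in_tuples [simp]: "[x] \<in> tuples A (Suc 0) \<longleftrightarrow> x \<in> A"
  by (auto simp: tuples_def)

lemma map_in_tuples: "\<sigma> \<in> B \<rightarrow> A \<Longrightarrow> ys \<in> tuples B n \<Longrightarrow> map \<sigma> ys \<in> tuples A n"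
  by (auto simp: tuples_def)

lemma operation_closed:
  "h \<in> operations A \<Longrightarrow> xs \<in> tuples A (fst h) \<Longrightarrow> snd h xs \<in> A"
  by (auto simp: operations_def)

lemma operation_eqI:
  assumes "g \<in> operations A" "h \<in> operations A" "fst g = fst h"
    and "\<And>xs. xs \<in> tuples A (fst h) \<Longrightarrow> snd g xs = snd h xs"
  shows "g = h"
proof (rule prod_eqI)
  show "snd g = snd h"
    using assms by (intro PiE_ext[of _ "tuples A (fst h)" "\<lambda>_. A"]) (auto simp: operations_def)
qed fact

lemma fst_op_of_map [simp]: "fst (op_of_map A f) = 1"
  by (simp add: op_of_map_def)

lemma op_of_map_of_op:
  assumes "h \<in> operations A" "fst h = 1"
  shows "op_of_map A (map_of_op A h) = h"
proof -
  obtain k where h: "h = (1, k)" and k: "k \<in> tuples A 1 \<rightarrow>\<^sub>E A"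
    using assms by (auto simp: operations_def)
  have "(\<lambda>xs\<in>tuples A 1. (\<lambda>x\<in>A. k [x]) (hd xs)) = k"
    using k by (intro extensionalityI[of _ "tuples A 1"]) (auto simp: PiE_def tuples_1)
  then show ?thesis
    by (simp add: h op_of_map_def map_of_op_def)
qed

lemma map_of_op_in_PiE:
  "h \<in> operations A \<Longrightarrow> fst h = 1 \<Longrightarrow> map_of_op A h \<in> A \<rightarrow>\<^sub>E A"
  by (auto simp: map_of_op_def intro!: operation_closed)

lemma unary_part_eq: "unary_part A F = map_of_op A ` {h \<in> F. fst h = 1}"
proof -
  have "{h \<in> F. fst h = 1} = Pair 1 ` clone_part F 1"
    by (auto simp: clone_part_def)
  then show ?thesis
    by (simp add: unary_part_def map_of_op_def image_image)
qed

lemma unary_partI: "h \<in> F \<Longrightarrow> fst h = 1 \<Longrightarrow> map_of_op A h \<in> unary_part A F"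
  by (simp add: unary_part_eq)

lemma unary_partE:
  assumes "f \<in> unary_part A F"
  obtains h where "h \<in> F" "fst h = 1" "f = map_of_op A h"
  using assms unfolding unary_part_eq by blast

lemma op_of_map_in:
  "F \<subseteq> operations A \<Longrightarrow> f \<in> unary_part A F \<Longrightarrow> op_of_map A f \<in> F"
  by (auto simp: unary_part_eq op_of_map_of_op subsetD)

lemma map_of_op_comp:
  assumes "g' \<in> operations A" "fst g' = 1"
  shows "map_of_op A (op_comp A 1 g [g']) = compose A (map_of_op A g) (map_of_op A g')"
  using map_of_op_in_PiE[OF assms]
  by (auto simp: map_of_op_def op_comp_def compose_def intro!: restrict_ext)

lemma map_of_op_proj: "map_of_op A (proj A 1 0) = (\<lambda>x\<in>A. x)"
  by (auto simp: map_of_op_def proj_def fun_eq_iff)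

lemma cloneD:
  assumes "clone A F"
  shows clone_subset: "F \<subseteq> operations A"
    and clone_proj: "\<And>n i. i < n \<Longrightarrow> proj A n i \<in> F"
    and clone_op_comp: "\<And>m h gs. composable F m h gs \<Longrightarrow> op_comp A m h gs \<in> F"
  using assms by (auto simp: clone_def)

lemma clone_homD:
  assumes "clone_hom A F B F' \<xi>"
  shows clone_hom_in: "\<And>h. h \<in> F \<Longrightarrow> \<xi> h \<in> F'"
    and clone_hom_fst: "\<And>h. h \<in> F \<Longrightarrow> fst (\<xi> h) = fst h"
    and clone_hom_proj: "\<And>n i. i < n \<Longrightarrow> \<xi> (proj A n i) = proj B n i"
    and clone_hom_comp: "\<And>m h gs. composable F m h gs \<Longrightarrow>
          \<xi> (op_comp A m h gs) = op_comp B m (\<xi> h) (map \<xi> gs)"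
  using assms by (auto simp: clone_hom_def)

section \<open>From pairs to tuples\<close>

lemma unary_part_compose:
  assumes F: "clone A F" and f: "f \<in> unary_part A F" and g: "g \<in> unary_part A F"
  shows "compose A f g \<in> unary_part A F"
proof -
  obtain h where h: "h \<in> F" "fst h = 1" "f = map_of_op A h"
    using f by (rule unary_partE)
  obtain k where k: "k \<in> F" "fst k = 1" "g = map_of_op A k"
    using g by (rule unary_partE)
  have "op_comp A 1 h [k] \<in> F"
    using h k by (intro clone_op_comp[OF F]) (simp add: composable_def)
  then have "map_of_op A (op_comp A 1 h [k]) \<in> unary_part A F"
    by (rule unary_partI) (simp add: op_comp_def)
  then show ?thesis
    using map_of_op_comp[of k A h] clone_subset[OF F] h k by auto
qed

text \<open>Induction on the tuple: if \<open>xs\<close> comes from the point \<open>c\<close>, weak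
  directedness for the pair of \<open>x\<close> and \<open>c\<close> yields a new common point
  \<open>d\<close>. Nonemptiness of \<open>A\<close> supplies a point for the empty tuple.\<close>

lemma weakly_directed_tuple:
  assumes S: "\<And>f g. f \<in> S \<Longrightarrow> g \<in> S \<Longrightarrow> compose A f g \<in> S"
    and wd: "weakly_directed A S" and "A \<noteq> {}" and "set xs \<subseteq> A"
  shows "\<exists>c\<in>A. \<exists>fs. set fs \<subseteq> S \<and> map (\<lambda>f. f c) fs = xs"
  using \<open>set xs \<subseteq> A\<close>
proof (induction xs)
  case Nil
  then show ?case using \<open>A \<noteq> {}\<close> by auto
next
  case (Cons x xs)
  then obtain c fs where c: "c \<in> A" "set fs \<subseteq> S" "map (\<lambda>f. f c) fs = xs"
    by auto
  obtain f g d where d: "f \<in> S" "g \<in> S" "d \<in> A" "f d = x" "g d = c"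
    using wd c(1) Cons.prems unfolding weakly_directed_def by (metis list.set_intros(1) subsetD)
  \<comment> \<open>Since \<open>g d = c\<close>, precomposing with \<open>g\<close> makes the old
    maps take at \<open>d\<close> the values they had at \<open>c\<close>.\<close>
  let ?fs = "f # map (\<lambda>k. compose A k g) fs"
  have "set ?fs \<subseteq> S"
    using c(2) d S by auto
  moreover have "map (\<lambda>f. f d) ?fs = x # xs"
    using d by (simp add: o_def compose_def flip: c(3))
  ultimately show ?case
    using d(3) by (intro bexI[of _ d] exI[of _ ?fs] conjI)
qed

section \<open>The induced isomorphism of unary parts\<close>

text \<open>Composition of self-maps is clone composition of unary operations, and the identity is
  the unary projection, so \<open>\<xi>\<close> respects the monoid structure.\<close>

lemma clone_iso_imp_monoid_iso:
  assumes F: "clone A F" and F': "clone B F'" and iso: "clone_iso A F B F' \<xi>"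
  shows "monoid_iso A (unary_part A F) B (unary_part B F')
           (\<lambda>f. map_of_op B (\<xi> (op_of_map A f)))"
    (is "monoid_iso _ ?M _ ?M' ?\<phi>")
proof -
  have hom: "clone_hom A F B F' \<xi>" and bij: "bij_betw \<xi> F F'"
    using iso by (auto simp: clone_iso_def)
  note sub = clone_subset[OF F] and sub' = clone_subset[OF F']
  let ?U = "{h \<in> F. fst h = 1}" and ?U' = "{h \<in> F'. fst h = 1}"
  \<comment> \<open>Every element of \<open>?M\<close> has the form \<open>map_of_op A h\<close>,
    and there the detour through \<open>op_of_map\<close> cancels.\<close>
  have \<phi>: "?\<phi> (map_of_op A h) = map_of_op B (\<xi> h)" if "h \<in> ?U" for h
    using that sub by (auto simp: op_of_map_of_op)
  have b1: "bij_betw (op_of_map A) ?M ?U"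
  proof (rule bij_betw_byWitness[where f' = "map_of_op A"])
    have id: "op_of_map A (map_of_op A h) = h" if "h \<in> ?U" for h
      using that sub by (intro op_of_map_of_op) auto
    then show "\<forall>h\<in>?U. op_of_map A (map_of_op A h) = h"
      by blast
    show "\<forall>f\<in>?M. map_of_op A (op_of_map A f) = f"
      unfolding unary_part_eq using id by simp
    show "op_of_map A ` ?M \<subseteq> ?U"
      using op_of_map_in[OF sub] by auto
    show "map_of_op A ` ?U \<subseteq> ?M"
      unfolding unary_part_eq by blast
  qed
  \<comment> \<open>A preimage of a unary operation is unary because \<open>\<xi>\<close> keeps
    arities, so the restriction is onto.\<close>
  have b2: "bij_betw \<xi> ?U ?U'"
  proof (rule bij_betw_subset[OF bij])
    show "\<xi> ` ?U = ?U'"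
      unfolding bij_betw_imp_surj_on[OF bij, symmetric] using clone_hom_fst[OF hom] by auto
  qed auto
  have b3: "bij_betw (map_of_op B) ?U' ?M'"
    using sub' unfolding unary_part_eq
    by (intro inj_on_imp_bij_betw inj_on_inverseI[of _ "op_of_map B"]) (auto intro: op_of_map_of_op)
  have bij\<phi>: "bij_betw ?\<phi> ?M ?M'"
    using bij_betw_trans[OF bij_betw_trans[OF b1 b2] b3] by (simp add: o_def)
  have comp: "?\<phi> (compose A f g) = compose B (?\<phi> f) (?\<phi> g)" if f: "f \<in> ?M" and g: "g \<in> ?M" for f g
  proof -
    obtain h where h: "h \<in> ?U" "f = map_of_op A h"
      using f by (blast elim: unary_partE)
    obtain k where k: "k \<in> ?U" "g = map_of_op A k"
      using g by (blast elim: unary_partE)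
    have c: "composable F 1 h [k]"
      using h k by (simp add: composable_def)
    have hk: "op_comp A 1 h [k] \<in> ?U"
      using clone_op_comp[OF F c] by (simp add: op_comp_def)
    have "?\<phi> (compose A f g) = ?\<phi> (map_of_op A (op_comp A 1 h [k]))"
      using h k sub by (subst map_of_op_comp) auto
    also have "\<dots> = map_of_op B (op_comp B 1 (\<xi> h) [\<xi> k])"
      using \<phi>[OF hk] clone_hom_comp[OF hom c] by simp
    \<comment> \<open>\<open>map_of_op_comp\<close> is stated with \<open>1\<close>; unfolding that
      to \<open>Suc 0\<close> would block the rewriting.\<close>
    also have "\<dots> = compose B (?\<phi> f) (?\<phi> g)"
      using h k \<phi>[OF h(1)] \<phi>[OF k(1)] subsetD[OF sub' clone_hom_in[OF hom, of k]]
        clone_hom_fst[OF hom, of k]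
      by (simp add: map_of_op_comp del: One_nat_def)
    finally show ?thesis .
  qed
  have "proj A 1 0 \<in> ?U"
    using clone_proj[OF F, of 0 1] by (simp add: proj_def)
  from \<phi>[OF this] have one: "?\<phi> (\<lambda>x\<in>A. x) = (\<lambda>y\<in>B. y)"
    by (simp add: map_of_op_proj clone_hom_proj[OF hom] del: One_nat_def)
  have "?\<phi> \<in> ?M \<rightarrow> ?M'"
    using bij_betw_apply[OF bij\<phi>] by blast
  then show ?thesis
    unfolding monoid_iso_def full_trans_monoid_def
    using bij\<phi> comp one by (intro conjI isoI homI) (auto simp: Pi_iff)
qed

section \<open>From unary operations to all arities\<close>

text \<open>\<open>\<xi>\<close> commutes with substituting unary operations into \<open>h\<close>,
  and \<open>unary\<close> evaluates at \<open>\<theta> c\<close> both the substituted operations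
  and the resulting composite. The hypothesis \<open>unary\<close> is conjugation in intertwining
  form, free of inverses.\<close>

lemma clone_iso_eq_op_conj:
  assumes F: "clone A F" and F': "clone B F'" and hom: "clone_hom A F B F' \<xi>"
    and wd: "weakly_directed A (unary_part A F)" and \<theta>: "bij_betw \<theta> A B"
    and unary: "\<And>f x. f \<in> unary_part A F \<Longrightarrow> x \<in> A \<Longrightarrow>
                  map_of_op B (\<xi> (op_of_map A f)) (\<theta> x) = \<theta> (f x)"
    and h: "h \<in> F"
  shows "\<xi> h = op_conj B \<theta> (inv_into A \<theta>) h"
proof (rule operation_eqI)
  note sub = clone_subset[OF F] and sub' = clone_subset[OF F']
  have \<sigma>: "inv_into A \<theta> \<in> B \<rightarrow> A"
    using bij_betw_inv_into[OF \<theta>] by (auto dest: bij_betw_apply)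
  have \<theta>_in: "\<theta> x \<in> B" if "x \<in> A" for x
    using \<theta> that by (auto dest: bij_betw_apply)
  show "\<xi> h \<in> operations B"
    using clone_hom_in[OF hom h] sub' by blast
  show "op_conj B \<theta> (inv_into A \<theta>) h \<in> operations B"
    using operation_closed[of h A] h sub \<theta>_in map_in_tuples[OF \<sigma>]
    by (auto simp: op_conj_def operations_def)
  show "fst (\<xi> h) = fst (op_conj B \<theta> (inv_into A \<theta>) h)"
    using clone_hom_fst[OF hom h] by (simp add: op_conj_def)
  fix ys assume "ys \<in> tuples B (fst (op_conj B \<theta> (inv_into A \<theta>) h))"
  then have ys: "ys \<in> tuples B (fst h)"
    by (simp add: op_conj_def)
  define xs where "xs = map (inv_into A \<theta>) ys"
  have xs: "xs \<in> tuples A (fst h)"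
    using map_in_tuples[OF \<sigma> ys] by (simp add: xs_def)
  have ys_eq: "ys = map \<theta> xs"
    using ys bij_betw_inv_into_right[OF \<theta>]
    by (auto simp: xs_def tuples_def subset_iff intro!: nth_equalityI)
  \<comment> \<open>The value of \<open>h\<close> at \<open>xs\<close> is an element of
    \<open>A\<close>, even if \<open>h\<close> is nullary and \<open>xs\<close> is empty.\<close>
  have "A \<noteq> {}"
    using operation_closed[of h A xs] h sub xs by auto
  then obtain c fs where c: "c \<in> A" and fs: "set fs \<subseteq> unary_part A F" "map (\<lambda>f. f c) fs = xs"
    using weakly_directed_tuple[of "unary_part A F" A xs] unary_part_compose[OF F] wd xs
    by (auto simp: tuples_def)
  \<comment> \<open>\<open>?p\<close> is the unary operation obtained by substituting the maps
    \<open>fs\<close> into \<open>h\<close>; its value at \<open>c\<close> is that of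
    \<open>h\<close> at \<open>xs\<close>.\<close>
  let ?gs = "map (op_of_map A) fs" and ?p = "op_comp A 1 h (map (op_of_map A) fs)"
  have len: "length fs = fst h"
    using xs fs(2) by (auto simp: tuples_def)
  have comp: "composable F 1 h ?gs"
    using h len fs(1) op_of_map_in[OF sub] by (auto simp: composable_def)
  have p: "?p \<in> F" "fst ?p = 1"
    using clone_op_comp[OF F comp] by (auto simp: op_comp_def)
  have "snd (\<xi> h) ys = snd (\<xi> h) (map (\<lambda>g. snd g [\<theta> c]) (map \<xi> ?gs))"
  proof -
    \<comment> \<open>Together the values \<open>\<theta> (f c)\<close> form
      \<open>map \<theta> xs\<close>, which is \<open>ys\<close>.\<close>
    have "snd (\<xi> (op_of_map A f)) [\<theta> c] = \<theta> (f c)" if "f \<in> set fs" for f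
      using unary[of f c] that fs(1) c \<theta>_in by (auto simp: map_of_op_def)
    then show ?thesis
      using fs(2) by (auto simp: ys_eq intro!: arg_cong[of _ _ "snd (\<xi> h)"])
  qed
  also have "\<dots> = snd (\<xi> ?p) [\<theta> c]"
    unfolding clone_hom_comp[OF hom comp] using c \<theta>_in by (simp add: op_comp_def)
  also have "\<dots> = \<theta> (snd ?p [c])"
  proof -
    have "map_of_op A ?p \<in> unary_part A F"
      using p by (rule unary_partI)
    moreover have "op_of_map A (map_of_op A ?p) = ?p"
      using p sub by (intro op_of_map_of_op) auto
    ultimately show ?thesis
      using unary[of "map_of_op A ?p" c] c \<theta>_in[OF c] by (simp add: map_of_op_def)
  qed
  also have "snd ?p [c] = snd h xs"
    using c fs(2) by (auto simp: op_comp_def op_of_map_def o_def)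
  also have "\<theta> (snd h xs) = snd (op_conj B \<theta> (inv_into A \<theta>) h) ys"
    using ys by (simp add: op_conj_def xs_def)
  finally show "snd (\<xi> h) ys = snd (op_conj B \<theta> (inv_into A \<theta>) h) ys" .
qed

section \<open>Conjugation as a homeomorphism\<close>

text \<open>Universal property of the disjoint union: openness in the sum is tested in each summand,
  where the preimage under \<open>f\<close> is that of its restriction.\<close>

lemma continuous_map_from_sum_topology:
  assumes "\<And>i. i \<in> I \<Longrightarrow> continuous_map (X i) Y (\<lambda>x. f (i, x))"
  shows "continuous_map (sum_topology X I) Y f"
  unfolding continuous_map_def
proof (intro conjI allI impI)
  show "f \<in> topspace (sum_topology X I) \<rightarrow> topspace Y"
    using assms by (fastforce simp: continuous_map_def)
  fix U assume U: "openin Y U"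
  have "{x. (i, x) \<in> topspace (sum_topology X I) \<and> f (i, x) \<in> U}
          = {x \<in> topspace (X i). f (i, x) \<in> U}" if "i \<in> I" for i
    using that by auto
  then show "openin (sum_topology X I) {x \<in> topspace (sum_topology X I). f x \<in> U}"
    using openin_continuous_map_preimage[OF assms U] by (auto simp: openin_sum_topology)
qed

text \<open>For fixed arity, the value of the conjugate at \<open>ys\<close> is a coordinate
  projection, at \<open>map \<sigma> ys\<close>, followed by \<open>\<theta>\<close>, which is
  continuous between discrete spaces.\<close>

lemma continuous_map_op_conj:
  assumes F: "F \<subseteq> operations A" and \<theta>: "\<theta> \<in> A \<rightarrow> B" and \<sigma>: "\<sigma> \<in> B \<rightarrow> A"
    and im: "op_conj B \<theta> \<sigma> ` F \<subseteq> F'"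
  shows "continuous_map (clone_topology A F) (clone_topology B F') (op_conj B \<theta> \<sigma>)"
  unfolding clone_topology_def
proof (rule continuous_map_from_sum_topology)
  fix n
  let ?X = "subtopology (product_topology (\<lambda>_. discrete_topology A) (tuples A n)) (clone_part F n)"
  let ?Y = "\<lambda>n. subtopology (product_topology (\<lambda>_. discrete_topology B) (tuples B n)) (clone_part F' n)"
  \<comment> \<open>Conjugation on the \<open>n\<close>-ary part with the arity tag stripped; the
    injection into the sum restores the tag at the end.\<close>
  let ?k = "\<lambda>f. \<lambda>ys\<in>tuples B n. \<theta> (f (map \<sigma> ys))"
  have "continuous_map ?X (discrete_topology B) (\<lambda>f. \<theta> (f (map \<sigma> ys)))" if "ys \<in> tuples B n" for ys
  proof -
    have "continuous_map ?X (discrete_topology A) (\<lambda>f. f (map \<sigma> ys))"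
      using map_in_tuples[OF \<sigma> that]
      by (intro continuous_map_from_subtopology continuous_map_product_projection)
    moreover have "continuous_map (discrete_topology A) (discrete_topology B) \<theta>"
      using \<theta> by simp
    ultimately have "continuous_map ?X (discrete_topology B) (\<theta> \<circ> (\<lambda>f. f (map \<sigma> ys)))"
      by (rule continuous_map_compose)
    then show ?thesis
      by (simp add: o_def)
  qed
  then have "continuous_map ?X (product_topology (\<lambda>_. discrete_topology B) (tuples B n)) ?k"
    by (auto simp: continuous_map_componentwise)
  moreover have "?k f \<in> clone_part F' n" if "f \<in> clone_part F n" for f
    using im that by (force simp: clone_part_def op_conj_def)
  ultimately have "continuous_map ?X (?Y n) ?k"
    by (auto simp: continuous_map_in_subtopology)
  then have "continuous_map ?X (sum_topology ?Y UNIV) ((\<lambda>f. (n, f)) \<circ> ?k)"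
    by (rule continuous_map_compose) (rule continuous_map_component_injection[OF UNIV_I])
  then show "continuous_map ?X (sum_topology ?Y UNIV) (\<lambda>f. op_conj B \<theta> \<sigma> (n, f))"
    by (simp add: op_conj_def o_def)
qed

text \<open>The maps cancel both on arguments and on values. The identity \<open>inv\<close> is
  one-sided, so that both inverse laws of a bijection are instances with the roles
  exchanged.\<close>

lemma op_conj_op_conj:
  assumes h: "h \<in> operations A" and \<theta>: "\<theta> \<in> A \<rightarrow> B" and inv: "\<And>x. x \<in> A \<Longrightarrow> \<sigma> (\<theta> x) = x"
  shows "op_conj A \<sigma> \<theta> (op_conj B \<theta> \<sigma> h) = h"
proof -
  have "map (\<sigma> \<circ> \<theta>) xs = xs" if "xs \<in> tuples A n" for xs n
    using that inv by (auto simp: tuples_def subset_iff intro!: map_idI)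
  then have "(\<lambda>xs\<in>tuples A (fst h). \<sigma> (\<theta> (snd h (map (\<sigma> \<circ> \<theta>) xs)))) = snd h"
    using h inv operation_closed[OF h]
    by (intro extensionalityI[of _ "tuples A (fst h)"]) (auto simp: operations_def PiE_def)
  moreover have "op_conj A \<sigma> \<theta> (op_conj B \<theta> \<sigma> h) =
      (fst h, \<lambda>xs\<in>tuples A (fst h). \<sigma> (\<theta> (snd h (map (\<sigma> \<circ> \<theta>) xs))))"
    using map_in_tuples[OF \<theta>] by (auto simp: op_conj_def intro!: restrict_ext)
  ultimately show ?thesis
    by simp
qed

lemma homeomorphic_map_op_conj:
  assumes F: "F \<subseteq> operations A" and F': "F' \<subseteq> operations B" and \<theta>: "bij_betw \<theta> A B"
    and im: "op_conj B \<theta> (inv_into A \<theta>) ` F = F'"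
  shows "homeomorphic_map (clone_topology A F) (clone_topology B F') (op_conj B \<theta> (inv_into A \<theta>))"
proof -
  let ?\<sigma> = "inv_into A \<theta>"
  have \<theta>_in: "\<theta> \<in> A \<rightarrow> B" and \<sigma>_in: "?\<sigma> \<in> B \<rightarrow> A"
    using \<theta> bij_betw_inv_into[OF \<theta>] by (auto dest: bij_betw_apply)
  have 1: "op_conj A ?\<sigma> \<theta> (op_conj B \<theta> ?\<sigma> h) = h" if "h \<in> F" for h
    using that F \<theta>_in bij_betw_inv_into_left[OF \<theta>] by (intro op_conj_op_conj) auto
  have 2: "op_conj B \<theta> ?\<sigma> (op_conj A ?\<sigma> \<theta> h) = h" if "h \<in> F'" for h
    using that F' \<sigma>_in bij_betw_inv_into_right[OF \<theta>] by (intro op_conj_op_conj) auto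
  have im': "op_conj A ?\<sigma> \<theta> ` F' \<subseteq> F"
    using 1 im by auto
  have "homeomorphic_maps (clone_topology A F) (clone_topology B F')
          (op_conj B \<theta> ?\<sigma>) (op_conj A ?\<sigma> \<theta>)"
    using continuous_map_op_conj[OF F \<theta>_in \<sigma>_in] continuous_map_op_conj[OF F' \<sigma>_in \<theta>_in im'] im 1 2
    by (simp add: homeomorphic_maps_def topspace_clone_topology[OF F] topspace_clone_topology[OF F'])
  then show ?thesis
    by (rule homeomorphic_maps_imp_map)
qed

section \<open>Transfer of action compatibility from the unary part to the clone\<close>

theorem theorem4p5:
  fixes A :: "'a set" and F :: "'a operation set"
    and K :: "('b set \<times> ('b \<Rightarrow> 'b) set) set"
    and C :: "('b set \<times> 'b operation set) set"
  assumes "\<And>B M. (B, M) \<in> K \<Longrightarrow> trans_monoid B M"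
    and "\<And>B F'. (B, F') \<in> C \<Longrightarrow> clone B F'"
    and "\<And>B F'. (B, F') \<in> C \<Longrightarrow> (B, unary_part B F') \<in> K"
    and "clone A F"
    and "weakly_directed A (unary_part A F)"
    and "monoid_automatic_action_compat A (unary_part A F) K"
  shows "clone_automatic_action_compat A F C \<and> clone_automatic_homeomorphicity A F C"
proof -
  \<comment> \<open>Both conclusions rest on this bijection: the first is its existence, and the
    second holds since conjugation by it is a homeomorphism.\<close>
  have conj: "\<exists>\<theta>. bij_betw \<theta> A B \<and> (\<forall>h\<in>F. \<xi> h = op_conj B \<theta> (inv_into A \<theta>) h)"
    if C: "(B, F') \<in> C" and AB: "A \<approx> B" and iso: "clone_iso A F B F' \<xi>" for B F' \<xi>
  proof -
    let ?\<phi> = "\<lambda>f. map_of_op B (\<xi> (op_of_map A f))"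
    have "monoid_iso A (unary_part A F) B (unary_part B F') ?\<phi>"
      using clone_iso_imp_monoid_iso[OF \<open>clone A F\<close> assms(2)[OF C] iso] .
    then obtain \<theta> where \<theta>: "bij_betw \<theta> A B"
      and \<phi>: "\<And>f. f \<in> unary_part A F \<Longrightarrow> ?\<phi> f = (\<lambda>y\<in>B. \<theta> (f (inv_into A \<theta> y)))"
      using assms(6) assms(3)[OF C] AB unfolding monoid_automatic_action_compat_def by blast
    \<comment> \<open>Evaluating at \<open>\<theta> x\<close> cancels the inverse and gives the
      intertwining form.\<close>
    have "?\<phi> f (\<theta> x) = \<theta> (f x)" if "f \<in> unary_part A F" "x \<in> A" for f x
      using that \<theta> by (simp add: \<phi> bij_betw_apply bij_betw_inv_into_left)
    then have "\<xi> h = op_conj B \<theta> (inv_into A \<theta>) h" if "h \<in> F" for h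
      using clone_iso_eq_op_conj[OF assms(4) assms(2)[OF C] _ assms(5) \<theta> _ that] iso
      by (auto simp: clone_iso_def)
    with \<theta> show ?thesis by blast
  qed
  moreover have "homeomorphic_map (clone_topology A F) (clone_topology B F') \<xi>"
    if C: "(B, F') \<in> C" and AB: "A \<approx> B" and iso: "clone_iso A F B F' \<xi>" for B F' \<xi>
  proof -
    obtain \<theta> where \<theta>: "bij_betw \<theta> A B" and \<xi>: "\<And>h. h \<in> F \<Longrightarrow> \<xi> h = op_conj B \<theta> (inv_into A \<theta>) h"
      using conj[OF C AB iso] by blast
    note sub = clone_subset[OF assms(4)] and sub' = clone_subset[OF assms(2)[OF C]]
    have "op_conj B \<theta> (inv_into A \<theta>) ` F = \<xi> ` F"
      using \<xi> by (intro image_cong) simp_all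
    also have "\<dots> = F'"
      using iso by (auto simp: clone_iso_def dest: bij_betw_imp_surj_on)
    \<comment> \<open>\<open>\<xi>\<close> is known to agree with the conjugation on
      \<open>F\<close>; this is the whole underlying space, so the homeomorphism carries
      over.\<close>
    finally show ?thesis
      using \<xi> by (intro homeomorphic_map_eq[OF homeomorphic_map_op_conj[OF sub sub' \<theta>]])
        (simp_all add: topspace_clone_topology[OF sub])
  qed
  ultimately show ?thesis
    unfolding clone_automatic_action_compat_def clone_automatic_homeomorphicity_def op_conj_def
    by blast
qed

end
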